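(* Let $k_{max1}=-1+\min\{N,\,M,\,N+2-N',\,M+2-M'\}$. Suppose that $0\le k\le k_{max1}$ and that $h_0,h_1,\dots,h_k$ are given scalar functions of $x$. Then the system of $k+1$ linear constraints $$u_j+\sum_{i=0}^{j}h_iv_{j-i}=0,\qquad j=0,1,\dots,k,$$ is invariant with respect to Darboux transformations such that $\det T_0\neq0$; that is, if these constraints hold for the coefficients $u_j,v_j$, then $\tilde u_j+\sum_{i=0}^{j}h_i\tilde v_{j-i}=0$ for $j=0,1,\dots,k$.
   Context: $x=(x^1,x^2)$; $,_1,,_2$ denote derivatives with respect to $x^1,x^2$, taking into account the possible dependence of the spectral parameter $\lambda$ on $x$. The linear problem $\Psi,_1=U\Psi$, $\Psi,_2=V\Psi$ has $n\times n$ matrices $$U=\sum_{k=0}^\infty u_k\lambda^{N-k},\qquad V=\sum_{k=0}^\infty v_k\lambda^{M-k},$$ for $\lambda$ near $\infty$, with $N,M$ fixed positive integers and $u_k=u_k(x)$, $v_k=v_k(x)$ (usually only finitely many are nonzero). The spectral parameter satisfies $$\lambda,_1=\sum_{k=0}^\infty a_k\lambda^{N'-k},\qquad \lambda,_2=\sum_{k=0}^\infty b_k\lambda^{M'-k},$$ with scalar $a_k=a_k(x)$, $b_k=b_k(x)$ and given integers $N',M'$ (in the nonisospectral case fixed by requiring $a_0\ne0$, $b_0\ne0$; the isospectral case is $\lambda,_1=\lambda,_2=0$). A Darboux transformation replaces $U,V$ by $$\tilde U=D,_1D^{-1}+DUD^{-1},\qquad \tilde V=D,_2D^{-1}+DVD^{-1},$$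 where the Darboux matrix $D$ is analytic at $\lambda=\infty$, $D=T_0+T_1\lambda^{-1}+T_2\lambda^{-2}+\dots$ with $T_k=T_k(x)$, and is such that $\tilde U,\tilde V$ are of the same form as $U,V$: $\tilde U=\sum_{k\ge0}\tilde u_k\lambda^{N-k}$, $\tilde V=\sum_{k\ge0}\tilde v_k\lambda^{M-k}$. The functions $h_i$ are not changed by the transformation. *)

theory Defs
  imports "HOL-Analysis.Analysis"
begin

type_synonym plane = "real \<times> real"

type_synonym 'n cmat = "complex ^ 'n ^ 'n"

text \<open>Multiplication of a matrix by a complex scalar; the library's \<open>*s\<close> scales vectors only.\<close>

definition cscale :: "complex \<Rightarrow> 'n cmat \<Rightarrow> 'n::finite cmat" (infixr \<open>*\<^sub>m\<close> 75)
  where "c *\<^sub>m A = map_matrix ((*) c) A"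

text \<open>
  The spectral parameter is written \<open>\<zeta>\<close>.  Functions of the position \<open>x\<close> and of \<open>\<zeta>\<close> near
  infinity are functions on a set \<open>{(x, \<zeta>). x \<in> \<Omega> \<and> norm \<zeta> > r x}\<close>.  For continuous \<open>r\<close> these sets form a basis of
  neighbourhoods of \<open>\<Omega> \<times> {\<infinity>}\<close> in the product of the open set \<open>\<Omega>\<close> and the Riemann sphere.
\<close>

definition near_infinity :: "plane set \<Rightarrow> (plane \<Rightarrow> real) \<Rightarrow> (plane \<times> complex) set"
  where "near_infinity \<Omega> r = {(x, \<zeta>). x \<in> \<Omega> \<and> norm \<zeta> > r x}"

definition scalar_expansion ::
    "(plane \<times> complex) set \<Rightarrow> int \<Rightarrow> (nat \<Rightarrow> plane \<Rightarrow> complex) \<Rightarrow> (plane \<times> complex \<Rightarrow> complex) \<Rightarrow> bool"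
  where "scalar_expansion W m c F \<longleftrightarrow>
    (\<forall>(x, \<zeta>)\<in>W. (\<lambda>k. c k x * \<zeta> powi (m - int k)) sums F (x, \<zeta>))"

definition matrix_expansion ::
    "(plane \<times> complex) set \<Rightarrow> int \<Rightarrow> (nat \<Rightarrow> plane \<Rightarrow> 'n cmat) \<Rightarrow> (plane \<times> complex \<Rightarrow> 'n::finite cmat) \<Rightarrow> bool"
  where "matrix_expansion W m c F \<longleftrightarrow>
    (\<forall>(x, \<zeta>)\<in>W. (\<lambda>k. (\<zeta> powi (m - int k)) *\<^sub>m c k x) sums F (x, \<zeta>))"

definition C1_on :: "('a::real_normed_vector \<Rightarrow> 'b::real_normed_vector) \<Rightarrow> 'a set \<Rightarrow> bool"
  where "C1_on f W \<longleftrightarrow>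
    (\<exists>f'. continuous_on W f' \<and> (\<forall>p\<in>W. (f has_derivative blinfun_apply (f' p)) (at p)))"

text \<open>
  The derivatives \<open>F,\<^sub>1\<close> and \<open>F,\<^sub>2\<close> are those with \<open>e = (1, 0)\<close> and \<open>e = (0, 1)\<close>.  They take
  into account that the spectral parameter depends on \<open>x\<close>: its own derivative in the direction \<open>e\<close>
  is \<open>\<Lambda> (x, \<zeta>)\<close>, and by the chain rule \<open>F\<close> is differentiated in the direction
  \<open>(e, \<Lambda> (x, \<zeta>))\<close>.  The lemma below confirms this.
\<close>

definition total_deriv ::
    "plane \<Rightarrow> (plane \<times> complex \<Rightarrow> complex) \<Rightarrow> (plane \<times> complex \<Rightarrow> 'b::real_normed_vector) \<Rightarrow> plane \<times> complex \<Rightarrow> 'b"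
  where "total_deriv e \<Lambda> F p = frechet_derivative F (at p) (e, \<Lambda> p)"

lemma total_deriv_along_spectral_parameter:
  fixes lam :: "plane \<Rightarrow> complex" and F :: "plane \<times> complex \<Rightarrow> 'b::real_normed_vector"
  assumes lam: "((\<lambda>t. lam (x + t *\<^sub>R e)) has_vector_derivative \<Lambda> (x, lam x)) (at 0)"
    and F: "F differentiable (at (x, lam x))"
  shows "((\<lambda>t. F (x + t *\<^sub>R e, lam (x + t *\<^sub>R e))) has_vector_derivative
           total_deriv e \<Lambda> F (x, lam x)) (at 0)"
proof -
  let ?c = "\<lambda>t. (x + t *\<^sub>R e, lam (x + t *\<^sub>R e))"
  have "((\<lambda>t. x + t *\<^sub>R e) has_vector_derivative e) (at 0)"
    unfolding has_vector_derivative_def by (auto intro!: derivative_eq_intros)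
  then have c: "(?c has_vector_derivative (e, \<Lambda> (x, lam x))) (at 0)"
    using lam by (rule has_vector_derivative_Pair)
  have "(F has_derivative frechet_derivative F (at (x, lam x))) (at (?c 0))"
    using F by (simp add: frechet_derivative_works)
  then have "(F has_derivative frechet_derivative F (at (x, lam x))) (at (?c 0) within range ?c)"
    by (rule has_derivative_at_withinI)
  from vector_derivative_diff_chain_within[OF c this]
  show ?thesis by (simp add: o_def total_deriv_def)
qed

definition darboux_transform ::
    "plane \<Rightarrow> (plane \<times> complex \<Rightarrow> complex) \<Rightarrow> (plane \<times> complex \<Rightarrow> 'n cmat)
      \<Rightarrow> (plane \<times> complex \<Rightarrow> 'n cmat) \<Rightarrow> plane \<times> complex \<Rightarrow> 'n::finite cmat"
  where "darboux_transform e \<Lambda> D U p =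
    total_deriv e \<Lambda> D p ** matrix_inv (D p) + D p ** U p ** matrix_inv (D p)"

definition k_max1 :: "int \<Rightarrow> int \<Rightarrow> int \<Rightarrow> int \<Rightarrow> int"
  where "k_max1 N M N' M' = - 1 + Min {N, M, N + 2 - N', M + 2 - M'}"

definition linear_constraints ::
    "plane set \<Rightarrow> nat \<Rightarrow> (nat \<Rightarrow> plane \<Rightarrow> complex) \<Rightarrow> (nat \<Rightarrow> plane \<Rightarrow> 'n cmat)
      \<Rightarrow> (nat \<Rightarrow> plane \<Rightarrow> 'n::finite cmat) \<Rightarrow> bool"
  where "linear_constraints \<Omega> k h u v \<longleftrightarrow>
    (\<forall>j\<le>k. \<forall>x\<in>\<Omega>. u j x + (\<Sum>i=0..j. h i x *\<^sub>m v (j - i) x) = 0)"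

end

theory Submission
  imports Defs "HOL-Complex_Analysis.Conformal_Mappings" "HOL-Library.Landau_Symbols"
begin

text \<open>
  Let \<open>H = \<Sum>\<^bsub>i \<le> j\<^esub> h\<^sub>i \<zeta>\<^bsup>N - M - i\<^esup>\<close>.  The constraints with indices up to \<open>j\<close> say that
  \<open>U + H V = O(\<zeta>\<^bsup>N - j - 1\<^esup>)\<close> as \<open>\<zeta> \<rightarrow> \<infinity>\<close> with \<open>x\<close> fixed.  The transformed
  matrices satisfy \<open>(U' + H V') D = D,\<^sub>1 + H D,\<^sub>2 + D (U + H V)\<close>.  Here the derivative of \<open>D\<close> in the
  position is bounded and the one in \<open>\<zeta>\<close> is \<open>O(\<zeta>\<^bsup>-2\<^esup>)\<close>, so \<open>D,\<^sub>1 = O(1) + O(\<zeta>\<^bsup>N' - 2\<^esup>)\<close> and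
  \<open>D,\<^sub>2 = O(1) + O(\<zeta>\<^bsup>M' - 2\<^esup>)\<close>.  The bound on \<open>k\<close> is exactly what makes both derivative terms
  \<open>O(\<zeta>\<^bsup>N - j - 1\<^esup>)\<close>, and since \<open>D \<rightarrow> T\<^sub>0\<close> is invertible, \<open>U' + H V'\<close> is
  \<open>O(\<zeta>\<^bsup>N - j - 1\<^esup>)\<close> as well.
\<close>

section \<open>Orders of growth of integer powers at infinity\<close>

lemma powi_bigo_mono:
  assumes "m \<le> n"
  shows "(\<lambda>\<zeta>. \<zeta> powi m) \<in> O[at_infinity](\<lambda>\<zeta>::complex. \<zeta> powi n)"
proof (rule bigoI[where c = 1])
  have "eventually (\<lambda>\<zeta>::complex. norm \<zeta> \<ge> 1) at_infinity"
    by (auto simp: eventually_at_infinity)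
  then show "eventually (\<lambda>\<zeta>::complex. norm (\<zeta> powi m) \<le> 1 * norm (\<zeta> powi n)) at_infinity"
    by eventually_elim (use assms in \<open>simp add: norm_power_int power_int_increasing\<close>)
qed

lemma eventually_nonzero_at_infinity:
  "eventually (\<lambda>\<zeta>::complex. \<zeta> \<noteq> 0) at_infinity"
  by (auto simp: eventually_at_infinity intro!: exI[of _ 1])

lemma powi_bigo_mult:
  assumes "f \<in> O[at_infinity](\<lambda>\<zeta>::complex. \<zeta> powi m)" "g \<in> O[at_infinity](\<lambda>\<zeta>. \<zeta> powi n)"
  shows "(\<lambda>\<zeta>. f \<zeta> * g \<zeta>) \<in> O[at_infinity](\<lambda>\<zeta>. \<zeta> powi (m + n))"
proof -
  have "(\<lambda>\<zeta>. f \<zeta> * g \<zeta>) \<in> O[at_infinity](\<lambda>\<zeta>. \<zeta> powi m * \<zeta> powi n)"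
    by (rule landau_o.big.mult[OF assms])
  also have "(\<lambda>\<zeta>. \<zeta> powi m * \<zeta> powi n) \<in> \<Theta>[at_infinity](\<lambda>\<zeta>::complex. \<zeta> powi (m + n))"
    by (rule bigthetaI_cong)
      (use eventually_nonzero_at_infinity in \<open>eventually_elim; simp add: power_int_add\<close>)
  finally show ?thesis .
qed

text \<open>Multiplying by \<open>\<zeta> powi (- m)\<close> leaves a constant of order
  \<open>inverse \<zeta>\<close>, which tends to 0. A coefficient can therefore be read off from
  growth alone.\<close>

lemma const_powi_not_bigo:
  assumes "(\<lambda>\<zeta>. c * \<zeta> powi m) \<in> O[at_infinity](\<lambda>\<zeta>::complex. \<zeta> powi (m - 1))"
  shows "c = 0"
proof -
  have "(\<lambda>\<zeta>. (c * \<zeta> powi m) * \<zeta> powi (- m)) \<in> O[at_infinity](\<lambda>\<zeta>::complex. \<zeta> powi (m - 1 + - m))"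
    by (rule powi_bigo_mult[OF assms]) simp
  also have "?this \<longleftrightarrow> (\<lambda>\<zeta>. c) \<in> O[at_infinity](\<lambda>\<zeta>::complex. inverse \<zeta>)"
  proof (rule landau_o.big.in_cong[THEN trans])
    show "eventually (\<lambda>\<zeta>. (c * \<zeta> powi m) * \<zeta> powi (- m) = c) at_infinity"
      using eventually_nonzero_at_infinity
      by eventually_elim (simp add: power_int_minus field_simps)
  qed (simp add: power_int_minus)
  finally obtain C where "eventually (\<lambda>\<zeta>. norm c \<le> C * norm (inverse (\<zeta>::complex))) at_infinity"
    by (auto elim: landau_o.bigE)
  moreover have "((\<lambda>\<zeta>::complex. C * norm (inverse \<zeta>)) \<longlongrightarrow> C * norm (0::complex)) at_infinity"
    by (intro tendsto_intros tendsto_inverse_0)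
  ultimately have "norm c \<le> 0"
    by (intro tendsto_lowerbound[where F = "at_infinity :: complex filter"])
      (auto simp: trivial_limit_at_infinity)
  then show "c = 0" by simp
qed

section \<open>Scalar Laurent series at infinity\<close>

lemma laurent_holomorphic_at_infinity:
  fixes c :: "nat \<Rightarrow> complex"
  assumes \<rho>: "\<rho> > 0"
    and sums: "\<And>\<zeta>. norm \<zeta> > \<rho> \<Longrightarrow> (\<lambda>k. c k * \<zeta> powi (- int k)) sums F \<zeta>"
  obtains g where "g holomorphic_on ball 0 (inverse \<rho>)"
    and "\<And>\<zeta>. norm \<zeta> > \<rho> \<Longrightarrow> F \<zeta> = g (inverse \<zeta>)"
proof -
  \<comment> \<open>In the variable \<open>w = inverse \<zeta>\<close> the series is a power series.
    The value \<open>c 0\<close> is its sum at \<open>w = 0\<close>, so infinity becomes an interior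
    point of the domain.\<close>
  define g where "g = (\<lambda>w. if w = 0 then c 0 else F (inverse w))"
  have *: "norm (inverse w) > \<rho>" if "norm w < inverse \<rho>" "w \<noteq> 0" for w :: complex
    using that \<rho> by (simp add: norm_inverse norm_divide field_simps)
  have "(\<lambda>k. c k * (w - 0) ^ k) sums g w" if "w \<in> ball 0 (inverse \<rho>)" for w
  proof (cases "w = 0")
    case True
    then show ?thesis by (simp add: g_def powser_sums_zero)
  next
    case False
    then show ?thesis
      using sums[of "inverse w"] * that by (simp add: g_def power_int_minus power_inverse)
  qed
  then have "g holomorphic_on ball 0 (inverse \<rho>)"
    by (rule power_series_holomorphic)
  moreover have "F \<zeta> = g (inverse \<zeta>)" if "norm \<zeta> > \<rho>" for \<zeta>
    using that \<rho> by (auto simp: g_def)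
  ultimately show ?thesis by (rule that)
qed

text \<open>After division by \<open>\<zeta> powi (m - int K)\<close> the remainder is again a
  series in nonpositive powers, so it has a limit at infinity. \<open>K = 0\<close> gives the growth
  of \<open>F\<close>, and \<open>K = 1\<close> isolates its leading term.\<close>

lemma laurent_remainder_bigo:
  fixes c :: "nat \<Rightarrow> complex"
  assumes sums: "\<And>\<zeta>. norm \<zeta> > \<rho> \<Longrightarrow> (\<lambda>k. c k * \<zeta> powi (m - int k)) sums F \<zeta>"
  shows "(\<lambda>\<zeta>. F \<zeta> - (\<Sum>k<K. c k * \<zeta> powi (m - int k))) \<in> O[at_infinity](\<lambda>\<zeta>. \<zeta> powi (m - int K))"
proof -
  let ?R = "\<lambda>\<zeta>. F \<zeta> - (\<Sum>k<K. c k * \<zeta> powi (m - int k))"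
  \<comment> \<open>\<open>\<rho>\<close> may be nonpositive here; the maximum with 1 supplies a
    positive radius and keeps \<open>\<zeta>\<close> away from 0.\<close>
  define \<rho>' where "\<rho>' = max 1 \<rho>"
  have sums': "(\<lambda>k. c (k + K) * \<zeta> powi (- int k)) sums (?R \<zeta> * \<zeta> powi (int K - m))"
    if "norm \<zeta> > \<rho>'" for \<zeta>
  proof -
    have "\<zeta> \<noteq> 0" "norm \<zeta> > \<rho>" using that by (auto simp: \<rho>'_def)
    have "(\<lambda>k. c (k + K) * \<zeta> powi (m - int (k + K)) * \<zeta> powi (int K - m)) sums (?R \<zeta> * \<zeta> powi (int K - m))"
      by (intro sums_mult2 sums_split_initial_segment sums \<open>norm \<zeta> > \<rho>\<close>)
    then show ?thesis
      using \<open>\<zeta> \<noteq> 0\<close> by (simp add: mult.assoc flip: power_int_add)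
  qed
  have "\<rho>' > 0" by (simp add: \<rho>'_def)
  obtain g where g: "g holomorphic_on ball 0 (inverse \<rho>')"
    and R: "\<And>\<zeta>. norm \<zeta> > \<rho>' \<Longrightarrow> ?R \<zeta> * \<zeta> powi (int K - m) = g (inverse \<zeta>)"
    using laurent_holomorphic_at_infinity[where F = "\<lambda>\<zeta>. ?R \<zeta> * \<zeta> powi (int K - m)", OF \<open>\<rho>' > 0\<close> sums']
    by blast
  have "isCont g 0"
    using holomorphic_on_imp_continuous_on[OF g]
    by (rule continuous_on_interior) (simp add: \<rho>'_def)
  then have lim: "((\<lambda>\<zeta>. g (inverse \<zeta>)) \<longlongrightarrow> g 0) at_infinity"
    using tendsto_inverse_0 by (rule isCont_tendsto_compose)
  have ev: "eventually (\<lambda>\<zeta>::complex. norm \<zeta> > \<rho>') at_infinity"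
    by (auto simp: eventually_at_infinity intro!: exI[of _ "\<rho>' + 1"])
  show ?thesis
  proof (rule bigoI_tendsto)
    show "((\<lambda>\<zeta>. ?R \<zeta> / \<zeta> powi (m - int K)) \<longlongrightarrow> g 0) at_infinity"
    proof (rule Lim_transform_eventually[OF lim])
      show "eventually (\<lambda>\<zeta>. g (inverse \<zeta>) = ?R \<zeta> / \<zeta> powi (m - int K)) at_infinity"
        using ev eventually_nonzero_at_infinity
        by eventually_elim (simp add: divide_inverse flip: R power_int_minus)
    qed
  qed (use eventually_nonzero_at_infinity in \<open>eventually_elim; simp\<close>)
qed

text \<open>In the coordinate \<open>inverse \<zeta>\<close> the exterior of the circle of radius
  \<open>R\<close>, together with infinity, is a closed disc bounded by that circle, and
  \<open>F\<close> extends holomorphically across its centre.\<close>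

lemma maximum_principle_at_infinity:
  fixes c :: "nat \<Rightarrow> complex"
  assumes "0 < \<rho>" "\<rho> < R"
    and sums: "\<And>\<zeta>. norm \<zeta> > \<rho> \<Longrightarrow> (\<lambda>k. c k * \<zeta> powi (- int k)) sums F \<zeta>"
    and bound: "\<And>\<zeta>. norm \<zeta> = R \<Longrightarrow> norm (F \<zeta>) \<le> B"
    and "norm \<zeta> \<ge> R"
  shows "norm (F \<zeta>) \<le> B"
proof -
  obtain g where g: "g holomorphic_on ball 0 (inverse \<rho>)"
    and F: "\<And>\<zeta>. norm \<zeta> > \<rho> \<Longrightarrow> F \<zeta> = g (inverse \<zeta>)"
    using laurent_holomorphic_at_infinity[OF \<open>0 < \<rho>\<close> sums] by blast
  have sub: "cball 0 (inverse R) \<subseteq> ball (0::complex) (inverse \<rho>)"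
    using less_imp_inverse_less[OF assms(2,1)] by auto
  have "norm (g (inverse \<zeta>)) \<le> B"
  proof (rule maximum_modulus_frontier[where f = g and S = "cball 0 (inverse R)"])
    show "g holomorphic_on interior (cball 0 (inverse R))"
      by (rule holomorphic_on_subset[OF g]) (use sub interior_subset in blast)
    show "continuous_on (closure (cball 0 (inverse R))) g"
      using holomorphic_on_imp_continuous_on[OF holomorphic_on_subset[OF g sub]] by simp
    show "norm (g w) \<le> B" if "w \<in> frontier (cball 0 (inverse R))" for w
    proof -
      have "norm (inverse w) = R"
        using that assms(1,2) by (simp add: norm_inverse)
      then show ?thesis
        using bound[of "inverse w"] F[of "inverse w"] assms(2) by simp
    qed
    show "inverse \<zeta> \<in> cball 0 (inverse R)"
      using assms(1,2,5) by (simp add: norm_inverse le_imp_inverse_le)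
  qed simp
  then show ?thesis using F assms by simp
qed

text \<open>The factors \<open>\<zeta> powi (N - M - int i)\<close> align the powers of
  \<open>G\<close> with those of \<open>F\<close>, so the coefficient of
  \<open>\<zeta> powi (N - int l)\<close> is the convolution that appears in the constraint with
  index \<open>l\<close>. The estimate serves both the original and the transformed
  matrices.\<close>

lemma laurent_constraint_bigo:
  fixes c d :: "nat \<Rightarrow> complex"
  assumes F: "\<And>\<zeta>. norm \<zeta> > \<rho> \<Longrightarrow> (\<lambda>k. c k * \<zeta> powi (N - int k)) sums F \<zeta>"
    and G: "\<And>\<zeta>. norm \<zeta> > \<rho> \<Longrightarrow> (\<lambda>k. d k * \<zeta> powi (M - int k)) sums G \<zeta>"
  shows "(\<lambda>\<zeta>. F \<zeta> + (\<Sum>i\<le>j. h i * \<zeta> powi (N - M - int i)) * G \<zeta>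
      - (\<Sum>l\<le>j. (c l + (\<Sum>i\<le>l. h i * d (l - i))) * \<zeta> powi (N - int l)))
    \<in> O[at_infinity](\<lambda>\<zeta>. \<zeta> powi (N - int j - 1))"
proof -
  \<comment> \<open>For each \<open>i\<close> the series of \<open>G\<close> is cut after index
    \<open>j - i\<close>: its remainder has order \<open>M - (j - i) - 1\<close>, which the factor
    shifts to \<open>N - j - 1\<close> whatever \<open>i\<close> is.\<close>
  have "(\<lambda>\<zeta>. (F \<zeta> - (\<Sum>l<Suc j. c l * \<zeta> powi (N - int l)))
      + (\<Sum>i\<le>j. (h i * \<zeta> powi (N - M - int i)) * (G \<zeta> - (\<Sum>l<Suc (j - i). d l * \<zeta> powi (M - int l)))))
    \<in> O[at_infinity](\<lambda>\<zeta>. \<zeta> powi (N - int j - 1))"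
  proof (rule sum_in_bigo(1), goal_cases)
    case 1
    show ?case
      using laurent_remainder_bigo[where K = "Suc j" and m = N, OF F] by (simp add: algebra_simps)
  next
    case 2
    show ?case
    proof (rule big_sum_in_bigo)
      show "(\<lambda>\<zeta>. (h i * \<zeta> powi (N - M - int i)) * (G \<zeta> - (\<Sum>l<Suc (j - i). d l * \<zeta> powi (M - int l))))
        \<in> O[at_infinity](\<lambda>\<zeta>. \<zeta> powi (N - int j - 1))" if "i \<in> {..j}" for i
      proof -
        have "(\<lambda>\<zeta>. (h i * \<zeta> powi (N - M - int i)) * (G \<zeta> - (\<Sum>l<Suc (j - i). d l * \<zeta> powi (M - int l))))
          \<in> O[at_infinity](\<lambda>\<zeta>. \<zeta> powi ((N - M - int i) + (M - int (Suc (j - i)))))"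
          by (intro powi_bigo_mult laurent_remainder_bigo[OF G]) auto
        also have "(N - M - int i) + (M - int (Suc (j - i))) = N - int j - 1"
          using that by auto
        finally show ?thesis .
      qed
    qed
  qed
  also have "?this \<longleftrightarrow> ?thesis"
  proof (rule landau_o.big.in_cong)
    \<comment> \<open>Terms are collected by the total index \<open>i + l\<close>, over the triangle
      \<open>i + l \<le> j\<close>.\<close>
    have reindex: "(\<Sum>i\<le>j. (h i * \<zeta> powi (N - M - int i)) * (\<Sum>l<Suc (j - i). d l * \<zeta> powi (M - int l)))
        = (\<Sum>l\<le>j. (\<Sum>i\<le>l. h i * d (l - i)) * \<zeta> powi (N - int l))" (is "?l = ?r") if "\<zeta> \<noteq> 0" for \<zeta>
    proof -
      have "?l = (\<Sum>i\<le>j. \<Sum>l\<le>j - i. h i * d l * \<zeta> powi (N - int (i + l)))"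
        unfolding sum_distrib_left lessThan_Suc_atMost
      proof (intro sum.cong refl)
        fix i l
        have "\<zeta> powi (N - int (i + l)) = \<zeta> powi (N - M - int i) * \<zeta> powi (M - int l)"
          by (subst power_int_add[symmetric]) (use that in \<open>simp_all add: algebra_simps\<close>)
        then show "h i * \<zeta> powi (N - M - int i) * (d l * \<zeta> powi (M - int l))
            = h i * d l * \<zeta> powi (N - int (i + l))"
          by simp
      qed
      also have "\<dots> = (\<Sum>(i, l)\<in>{(i, l). i + l \<le> j}. h i * d l * \<zeta> powi (N - int (i + l)))"
        by (subst sum.Sigma) (auto intro!: sum.cong)
      also have "\<dots> = (\<Sum>l\<le>j. \<Sum>i\<le>l. h i * d (l - i) * \<zeta> powi (N - int (i + (l - i))))"
        by (rule sum.triangle_reindex_eq)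
      also have "\<dots> = ?r"
        by (auto simp: sum_distrib_right intro!: sum.cong)
      finally show ?thesis .
    qed
    show "eventually (\<lambda>\<zeta>. (F \<zeta> - (\<Sum>l<Suc j. c l * \<zeta> powi (N - int l)))
      + (\<Sum>i\<le>j. (h i * \<zeta> powi (N - M - int i)) * (G \<zeta> - (\<Sum>l<Suc (j - i). d l * \<zeta> powi (M - int l))))
      = F \<zeta> + (\<Sum>i\<le>j. h i * \<zeta> powi (N - M - int i)) * G \<zeta>
      - (\<Sum>l\<le>j. (c l + (\<Sum>i\<le>l. h i * d (l - i))) * \<zeta> powi (N - int l))) at_infinity"
    proof (rule eventually_mono[OF eventually_nonzero_at_infinity])
      fix \<zeta> :: complex assume "\<zeta> \<noteq> 0"
      show "(F \<zeta> - (\<Sum>l<Suc j. c l * \<zeta> powi (N - int l)))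
        + (\<Sum>i\<le>j. (h i * \<zeta> powi (N - M - int i)) * (G \<zeta> - (\<Sum>l<Suc (j - i). d l * \<zeta> powi (M - int l))))
        = F \<zeta> + (\<Sum>i\<le>j. h i * \<zeta> powi (N - M - int i)) * G \<zeta>
        - (\<Sum>l\<le>j. (c l + (\<Sum>i\<le>l. h i * d (l - i))) * \<zeta> powi (N - int l))"
        unfolding lessThan_Suc_atMost[of j] right_diff_distrib sum_subtractf sum.distrib distrib_right reindex[OF \<open>\<zeta> \<noteq> 0\<close>]
          sum_distrib_right[of _ _ "G \<zeta>"]
        by (rule add_diff_add[symmetric])
    qed
  qed
  finally show ?thesis .
qed

section \<open>Growth of the total derivative\<close>

lemma has_derivative_norm_le_Lipschitz:
  assumes f: "(f has_derivative f') (at x)" and "\<epsilon> > 0"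
    and lip: "\<And>y. norm (y - x) < \<epsilon> \<Longrightarrow> norm (f y - f x) \<le> C * norm (y - x)"
  shows "norm (f' e) \<le> C * norm e"
proof (cases "e = 0")
  case True
  then show ?thesis using has_derivative_bounded_linear[OF f] by (simp add: linear_simps)
next
  case False
  interpret f': bounded_linear f' by (rule has_derivative_bounded_linear[OF f])
  have *: "norm (f' e) \<le> (C + \<eta>) * norm e" if "\<eta> > 0" for \<eta>
  proof -
    obtain \<delta> where "\<delta> > 0"
      and \<delta>: "\<And>y. norm (y - x) < \<delta> \<Longrightarrow> norm (f y - f x - f' (y - x)) \<le> \<eta> * norm (y - x)"
      using f \<open>\<eta> > 0\<close> unfolding has_derivative_at_alt by blast
    \<comment> \<open>The step \<open>t\<close> along \<open>e\<close> is small enough for both the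
      Lipschitz bound and the linear approximation with error \<open>\<eta>\<close>. Both bounds are
      linear in \<open>t\<close>, which then cancels.\<close>
    define t where "t = min \<epsilon> \<delta> / (2 * norm e)"
    have "t > 0" using \<open>\<epsilon> > 0\<close> \<open>\<delta> > 0\<close> False by (simp add: t_def)
    have "t * norm e = min \<epsilon> \<delta> / 2" using False by (simp add: t_def)
    then have t: "norm (t *\<^sub>R e) < \<epsilon>" "norm (t *\<^sub>R e) < \<delta>"
      using \<open>t > 0\<close> \<open>\<epsilon> > 0\<close> \<open>\<delta> > 0\<close> by auto
    have "norm (f' (t *\<^sub>R e)) \<le> norm (f (x + t *\<^sub>R e) - f x)
        + norm (f (x + t *\<^sub>R e) - f x - f' (t *\<^sub>R e))"
      by norm
    also have "\<dots> \<le> C * norm (t *\<^sub>R e) + \<eta> * norm (t *\<^sub>R e)"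
      using lip[of "x + t *\<^sub>R e"] \<delta>[of "x + t *\<^sub>R e"] t by simp
    finally have "t * norm (f' e) \<le> t * ((C + \<eta>) * norm e)"
      using \<open>t > 0\<close> by (simp add: f'.scaleR algebra_simps)
    then show ?thesis using \<open>t > 0\<close> by simp
  qed
  show ?thesis
  proof (rule field_le_epsilon)
    fix \<eta> :: real assume "\<eta> > 0"
    then show "norm (f' e) \<le> C * norm e + \<eta>"
      using *[of "\<eta> / norm e"] False by (simp add: algebra_simps)
  qed
qed

lemma scalar_expansionD:
  assumes "scalar_expansion (near_infinity \<Omega> r) m c F" "x \<in> \<Omega>" "norm \<zeta> > r x"
  shows "(\<lambda>k. c k x * \<zeta> powi (m - int k)) sums F (x, \<zeta>)"
  using bspec[OF assms(1)[unfolded scalar_expansion_def], of "(x, \<zeta>)"] assms(2,3)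
  by (simp add: near_infinity_def)

text \<open>The hypothesis that \<open>d\<close> is \<open>C\<^sup>1\<close> gives no uniformity as \<open>\<zeta> \<rightarrow> \<infinity>\<close>.  It comes from the
  maximum principle, which extends a Lipschitz estimate in the position from one circle to its exterior.\<close>

lemma x_derivative_bigo:
  fixes d :: "plane \<times> complex \<Rightarrow> complex"
  assumes "open \<Omega>" "continuous_on \<Omega> r" "x \<in> \<Omega>"
    and expansion: "scalar_expansion (near_infinity \<Omega> r) 0 c d"
    and cont: "continuous_on (near_infinity \<Omega> r) d'"
    and deriv: "\<And>p. p \<in> near_infinity \<Omega> r \<Longrightarrow> (d has_derivative blinfun_apply (d' p)) (at p)"
  shows "(\<lambda>\<zeta>. d' (x, \<zeta>) (e, 0)) \<in> O[at_infinity](\<lambda>\<zeta>. \<zeta> powi 0)"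
proof -
  \<comment> \<open>Since \<open>\<rho>\<close> lies strictly above \<open>r x\<close>, continuity
    of \<open>r\<close> gives a ball around \<open>x\<close> on which \<open>r < \<rho>\<close>;
    over it all expansions hold for \<open>norm \<zeta> > \<rho>\<close>. The larger
    \<open>R\<close> leaves a margin for the maximum principle.\<close>
  define \<rho> where "\<rho> = max 0 (r x) + 1"
  define R where "R = \<rho> + 1"
  have "\<rho> > 0" "\<rho> < R" "r x < \<rho>" by (auto simp: \<rho>_def R_def)
  have "open (r -` {..<\<rho>} \<inter> \<Omega>)"
    using continuous_on_open_vimage[OF \<open>open \<Omega>\<close>, of r] \<open>continuous_on \<Omega> r\<close> by simp
  moreover have "x \<in> r -` {..<\<rho>} \<inter> \<Omega>"
    using \<open>r x < \<rho>\<close> \<open>x \<in> \<Omega>\<close> by simp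
  ultimately obtain \<epsilon> where "\<epsilon> > 0" and \<epsilon>: "cball x \<epsilon> \<subseteq> r -` {..<\<rho>} \<inter> \<Omega>"
    using open_contains_cball_eq by blast
  have in_W: "(y, \<zeta>) \<in> near_infinity \<Omega> r" if "y \<in> cball x \<epsilon>" "norm \<zeta> > \<rho>" for y \<zeta>
    using that \<epsilon> by (auto simp: near_infinity_def intro: less_trans)
  \<comment> \<open>The exterior of the circle is not compact, but the circle is: continuity of
    \<open>d'\<close> gives a bound \<open>C\<close> there that is uniform in the position.\<close>
  have "compact (d' ` (cball x \<epsilon> \<times> sphere 0 R))"
  proof (rule compact_continuous_image)
    show "continuous_on (cball x \<epsilon> \<times> sphere 0 R) d'"
      by (rule continuous_on_subset[OF cont]) (use \<open>\<rho> < R\<close> in_W in auto)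
  qed (intro compact_Times compact_cball compact_sphere)
  then have "bounded (d' ` (cball x \<epsilon> \<times> sphere 0 R))"
    by (rule compact_imp_bounded)
  then obtain C where "\<forall>f\<in>d' ` (cball x \<epsilon> \<times> sphere 0 R). norm f \<le> C"
    unfolding bounded_iff by blast
  then have C: "norm (d' (y, \<zeta>)) \<le> C" if "y \<in> cball x \<epsilon>" "norm \<zeta> = R" for y \<zeta>
    using that by fastforce
  \<comment> \<open>Mean value inequality in the position on the convex ball, with
    \<open>\<zeta>\<close> fixed on the circle.\<close>
  have circle: "norm (d (y, \<zeta>) - d (x, \<zeta>)) \<le> C * norm (y - x)"
    if "y \<in> cball x \<epsilon>" "norm \<zeta> = R" for y \<zeta>
  proof (rule differentiable_bound[where S = "cball x \<epsilon>" and f = "\<lambda>z. d (z, \<zeta>)"])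
    fix z assume z: "z \<in> cball x \<epsilon>"
    have "((\<lambda>z. d (z, \<zeta>)) has_derivative (\<lambda>v. d' (z, \<zeta>) (v, 0))) (at z)"
      by (rule has_derivative_compose[of "\<lambda>z. (z, \<zeta>)" "\<lambda>v. (v, 0)" z UNIV d])
        (use that z \<open>\<rho> < R\<close> in_W deriv in \<open>auto intro!: derivative_eq_intros simp del: mem_cball\<close>)
    then show "((\<lambda>z. d (z, \<zeta>)) has_derivative (\<lambda>v. d' (z, \<zeta>) (v, 0))) (at z within cball x \<epsilon>)"
      by (rule has_derivative_at_withinI)
    show "onorm (\<lambda>v. d' (z, \<zeta>) (v, 0)) \<le> C"
    proof (rule onorm_le)
      fix v :: plane
      have "norm (d' (z, \<zeta>) (v, 0)) \<le> norm (d' (z, \<zeta>)) * norm (v, 0::complex)"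
        by (rule norm_blinfun)
      also have "\<dots> \<le> C * norm v"
        using C[OF z] that by (simp add: mult_right_mono)
      finally show "norm (d' (z, \<zeta>) (v, 0)) \<le> C * norm v" .
    qed
  qed (use that \<open>\<epsilon> > 0\<close> in auto)
  \<comment> \<open>For fixed \<open>y\<close> the difference is a series in nonpositive powers with
    coefficients \<open>c k y - c k x\<close>, so the bound passes to the exterior with the same
    constant.\<close>
  have outside: "norm (d (y, \<zeta>) - d (x, \<zeta>)) \<le> C * norm (y - x)"
    if "y \<in> cball x \<epsilon>" "norm \<zeta> \<ge> R" for y \<zeta>
  proof (rule maximum_principle_at_infinity[OF \<open>\<rho> > 0\<close> \<open>\<rho> < R\<close>, where F = "\<lambda>\<zeta>. d (y, \<zeta>) - d (x, \<zeta>)"])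
    fix \<zeta> :: complex assume "norm \<zeta> > \<rho>"
    then have "(\<lambda>k. c k y * \<zeta> powi (0 - int k) - c k x * \<zeta> powi (0 - int k)) sums (d (y, \<zeta>) - d (x, \<zeta>))"
      using in_W[of x \<zeta>] in_W[of y \<zeta>] that \<open>\<epsilon> > 0\<close>
      by (intro sums_diff scalar_expansionD[OF expansion]) (auto simp: near_infinity_def)
    then show "(\<lambda>k. (c k y - c k x) * \<zeta> powi - int k) sums (d (y, \<zeta>) - d (x, \<zeta>))"
      by (simp add: algebra_simps)
  qed (use that circle in auto)
  show ?thesis
  proof (rule bigoI)
    \<comment> \<open>The Lipschitz estimate at \<open>x\<close> turns back into a bound on the
      derivative, with \<open>C\<close> independent of \<open>\<zeta>\<close>.\<close>
    have "norm (d' (x, \<zeta>) (e, 0)) \<le> C * norm e" if "norm \<zeta> \<ge> R" for \<zeta>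
    proof (rule has_derivative_norm_le_Lipschitz[OF _ \<open>\<epsilon> > 0\<close>, where f = "\<lambda>y. d (y, \<zeta>)"])
      show "((\<lambda>y. d (y, \<zeta>)) has_derivative (\<lambda>v. d' (x, \<zeta>) (v, 0))) (at x)"
        by (rule has_derivative_compose[of "\<lambda>z. (z, \<zeta>)" "\<lambda>v. (v, 0)" x UNIV d])
          (use that \<open>\<epsilon> > 0\<close> \<open>\<rho> < R\<close> in_W deriv in \<open>auto intro!: derivative_eq_intros\<close>)
      show "norm (d (y, \<zeta>) - d (x, \<zeta>)) \<le> C * norm (y - x)" if "norm (y - x) < \<epsilon>" for y
        using outside[of y \<zeta>] that \<open>norm \<zeta> \<ge> R\<close> by (simp add: dist_norm norm_minus_commute)
    qed
    then show "eventually (\<lambda>\<zeta>. norm (d' (x, \<zeta>) (e, 0)) \<le> (C * norm e) * norm (\<zeta> powi 0)) at_infinity"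
      by (auto simp: eventually_at_infinity)
  qed
qed

text \<open>With \<open>d (x, \<zeta>) = g (inverse \<zeta>)\<close>, differentiation yields
  \<open>deriv g (inverse \<zeta>)\<close>, bounded near infinity, times the inner derivative
  \<open>- (\<zeta> powi - 2)\<close>. This gain of two powers is the source of the
  \<open>+ 2\<close> in \<open>k_max1\<close>.\<close>

lemma spectral_derivative_bigo:
  fixes d :: "plane \<times> complex \<Rightarrow> complex"
  assumes "x \<in> \<Omega>"
    and expansion: "scalar_expansion (near_infinity \<Omega> r) 0 c d"
    and deriv: "\<And>p. p \<in> near_infinity \<Omega> r \<Longrightarrow> (d has_derivative d' p) (at p)"
    and \<Lambda>: "\<Lambda> \<in> O[at_infinity](\<lambda>\<zeta>. \<zeta> powi m)"
  shows "(\<lambda>\<zeta>. d' (x, \<zeta>) (0, \<Lambda> \<zeta>)) \<in> O[at_infinity](\<lambda>\<zeta>. \<zeta> powi (m - 2))"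
proof -
  define \<rho> where "\<rho> = max 0 (r x) + 1"
  have "\<rho> > 0" "r x < \<rho>" by (auto simp: \<rho>_def)
  then have in_W: "(x, \<zeta>) \<in> near_infinity \<Omega> r" if "norm \<zeta> > \<rho>" for \<zeta>
    using that \<open>x \<in> \<Omega>\<close> by (auto simp: near_infinity_def)
  have sums: "(\<lambda>k. c k x * \<zeta> powi - int k) sums d (x, \<zeta>)" if "norm \<zeta> > \<rho>" for \<zeta>
    using scalar_expansionD[OF expansion \<open>x \<in> \<Omega>\<close>] that \<open>r x < \<rho>\<close> by simp
  obtain g where g: "g holomorphic_on ball 0 (inverse \<rho>)"
    and d: "\<And>\<zeta>. norm \<zeta> > \<rho> \<Longrightarrow> d (x, \<zeta>) = g (inverse \<zeta>)"
    using laurent_holomorphic_at_infinity[where F = "\<lambda>\<zeta>. d (x, \<zeta>)", OF \<open>\<rho> > 0\<close> sums] by blast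
  have chain: "d' (x, \<zeta>) (0, h) = deriv g (inverse \<zeta>) * (- (\<zeta> powi - 2)) * h" if \<zeta>: "norm \<zeta> > \<rho>" for \<zeta> h
  proof -
    have "\<zeta> \<noteq> 0" using \<zeta> \<open>\<rho> > 0\<close> by auto
    have "inverse \<zeta> \<in> ball 0 (inverse \<rho>)"
      using less_imp_inverse_less[OF \<zeta> \<open>\<rho> > 0\<close>] by (simp add: norm_inverse)
    then have "(g has_field_derivative deriv g (inverse \<zeta>)) (at (inverse \<zeta>))"
      by (rule holomorphic_derivI[OF g open_ball])
    from DERIV_chain2[OF this DERIV_inverse[OF \<open>\<zeta> \<noteq> 0\<close>]]
    have "((\<lambda>z. g (inverse z)) has_field_derivative deriv g (inverse \<zeta>) * (- (\<zeta> powi - 2))) (at \<zeta>)"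
      by (simp add: power_int_minus power2_eq_square eval_nat_numeral)
    then have "((\<lambda>z. d (x, z)) has_field_derivative deriv g (inverse \<zeta>) * (- (\<zeta> powi - 2))) (at \<zeta>)"
      by (rule has_field_derivative_transform_within_open[where S = "- cball 0 \<rho>"])
        (use \<zeta> d in auto)
    moreover have "((\<lambda>z. d (x, z)) has_derivative (\<lambda>h. d' (x, \<zeta>) (0, h))) (at \<zeta>)"
      by (rule has_derivative_compose[of "\<lambda>z. (x, z)" "\<lambda>h. (0, h)" \<zeta> UNIV d])
        (use \<zeta> in_W deriv in \<open>auto intro!: derivative_eq_intros\<close>)
    \<comment> \<open>The complex derivative obtained from \<open>g\<close> and the real partial
      derivative given by \<open>d'\<close> belong to the same map, hence coincide.\<close>
    ultimately have "(\<lambda>h. d' (x, \<zeta>) (0, h)) = (*) (deriv g (inverse \<zeta>) * (- (\<zeta> powi - 2)))"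
      unfolding has_field_derivative_def by (metis has_derivative_unique)
    then show ?thesis by metis
  qed
  have "isCont (deriv g) 0"
    using holomorphic_on_imp_continuous_on[OF holomorphic_deriv[OF g open_ball]]
    by (rule continuous_on_interior) (simp add: \<open>\<rho> > 0\<close>)
  then have "((\<lambda>\<zeta>. deriv g (inverse \<zeta>)) \<longlongrightarrow> deriv g 0) at_infinity"
    using tendsto_inverse_0 by (rule isCont_tendsto_compose)
  then have "(\<lambda>\<zeta>. deriv g (inverse \<zeta>)) \<in> O[at_infinity](\<lambda>\<zeta>. \<zeta> powi 0)"
    by (intro bigoI_tendsto) auto
  then have "(\<lambda>\<zeta>. deriv g (inverse \<zeta>) * (- (\<zeta> powi - 2)) * \<Lambda> \<zeta>) \<in> O[at_infinity](\<lambda>\<zeta>. \<zeta> powi (0 + - 2 + m))"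
    by (intro powi_bigo_mult \<Lambda>) auto
  also have "?this \<longleftrightarrow> ?thesis"
  proof -
    have "eventually (\<lambda>\<zeta>. deriv g (inverse \<zeta>) * (- (\<zeta> powi - 2)) * \<Lambda> \<zeta> = d' (x, \<zeta>) (0, \<Lambda> \<zeta>)) at_infinity"
      by (auto simp: eventually_at_infinity chain intro!: exI[of _ "\<rho> + 1"])
    from landau_o.big.in_cong[OF this] show ?thesis by simp
  qed
  finally show ?thesis .
qed

lemma total_deriv_eq:
  "(F has_derivative F') (at p) \<Longrightarrow> total_deriv e \<Lambda> F p = F' (e, \<Lambda> p)"
  by (metis frechet_derivative_at total_deriv_def)

text \<open>By linearity the direction \<open>(e, \<Lambda> (x, \<zeta>))\<close> splits into
  \<open>(e, 0)\<close>, contributing order 0, and \<open>(0, \<Lambda> (x, \<zeta>))\<close>,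
  contributing order \<open>m - 2\<close>; the maximum covers both.\<close>

lemma total_deriv_bigo:
  fixes d :: "plane \<times> complex \<Rightarrow> complex"
  assumes "open \<Omega>" "continuous_on \<Omega> r" "x \<in> \<Omega>"
    and "scalar_expansion (near_infinity \<Omega> r) 0 c d"
    and "C1_on d (near_infinity \<Omega> r)"
    and "scalar_expansion (near_infinity \<Omega> r) m a \<Lambda>"
  shows "(\<lambda>\<zeta>. total_deriv e \<Lambda> d (x, \<zeta>)) \<in> O[at_infinity](\<lambda>\<zeta>. \<zeta> powi (max 0 (m - 2)))"
proof -
  obtain d' where d': "continuous_on (near_infinity \<Omega> r) d'"
    "\<And>p. p \<in> near_infinity \<Omega> r \<Longrightarrow> (d has_derivative blinfun_apply (d' p)) (at p)"
    using assms(5) by (auto simp: C1_on_def)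
  from laurent_remainder_bigo[of "r x", OF scalar_expansionD[OF assms(6,3)], of 0]
  have \<Lambda>: "(\<lambda>\<zeta>. \<Lambda> (x, \<zeta>)) \<in> O[at_infinity](\<lambda>\<zeta>. \<zeta> powi m)" by simp
  have "(\<lambda>\<zeta>. d' (x, \<zeta>) (e, 0) + d' (x, \<zeta>) (0, \<Lambda> (x, \<zeta>))) \<in> O[at_infinity](\<lambda>\<zeta>. \<zeta> powi (max 0 (m - 2)))"
  proof (rule sum_in_bigo(1))
    show "(\<lambda>\<zeta>. d' (x, \<zeta>) (e, 0)) \<in> O[at_infinity](\<lambda>\<zeta>. \<zeta> powi (max 0 (m - 2)))"
      by (rule landau_o.big_trans[OF x_derivative_bigo[OF assms(1-4) d'] powi_bigo_mono]) auto
    show "(\<lambda>\<zeta>. d' (x, \<zeta>) (0, \<Lambda> (x, \<zeta>))) \<in> O[at_infinity](\<lambda>\<zeta>. \<zeta> powi (max 0 (m - 2)))"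
      by (rule landau_o.big_trans[OF spectral_derivative_bigo[OF assms(3,4) d'(2) \<Lambda>] powi_bigo_mono]) auto
  qed
  also have "?this \<longleftrightarrow> ?thesis"
  proof (rule landau_o.big.in_cong)
    have "total_deriv e \<Lambda> d (x, \<zeta>) = d' (x, \<zeta>) (e, 0) + d' (x, \<zeta>) (0, \<Lambda> (x, \<zeta>))" if "norm \<zeta> > r x" for \<zeta>
    proof -
      have "(x, \<zeta>) \<in> near_infinity \<Omega> r" using that \<open>x \<in> \<Omega>\<close> by (simp add: near_infinity_def)
      from total_deriv_eq[OF d'(2)[OF this]] show ?thesis
        by (simp flip: blinfun.add_right)
    qed
    then show "eventually (\<lambda>\<zeta>. d' (x, \<zeta>) (e, 0) + d' (x, \<zeta>) (0, \<Lambda> (x, \<zeta>)) = total_deriv e \<Lambda> d (x, \<zeta>)) at_infinity"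
      by (auto simp: eventually_at_infinity intro!: exI[of _ "r x + 1"])
  qed
  finally show ?thesis .
qed

text \<open>The coefficient of \<open>\<zeta> powi m\<close> in the sum of products can only be the
  sum of the \<open>c s * t s\<close>, and the assumed growth excludes it. With \<open>s\<close> as
  the summation index of a matrix product, this treats one entry of \<open>(U' + H V') D\<close> at
  a time.\<close>

lemma leading_coefficients_orthogonal:
  fixes P D :: "'a \<Rightarrow> complex \<Rightarrow> complex"
  assumes P: "\<And>s. s \<in> S \<Longrightarrow> (\<lambda>\<zeta>. P s \<zeta> - c s * \<zeta> powi m) \<in> O[at_infinity](\<lambda>\<zeta>. \<zeta> powi (m - 1))"
    and D: "\<And>s. s \<in> S \<Longrightarrow> (\<lambda>\<zeta>. D s \<zeta> - t s) \<in> O[at_infinity](\<lambda>\<zeta>. \<zeta> powi - 1)"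
    and PD: "(\<lambda>\<zeta>. \<Sum>s\<in>S. P s \<zeta> * D s \<zeta>) \<in> O[at_infinity](\<lambda>\<zeta>. \<zeta> powi (m - 1))"
  shows "(\<Sum>s\<in>S. c s * t s) = 0"
proof (rule const_powi_not_bigo)
  have D0: "D s \<in> O[at_infinity](\<lambda>\<zeta>. \<zeta> powi 0)" if "s \<in> S" for s
  proof -
    have "(\<lambda>\<zeta>. D s \<zeta> - t s) \<in> O[at_infinity](\<lambda>\<zeta>. \<zeta> powi 0)"
      by (rule landau_o.big_trans[OF D[OF that] powi_bigo_mono]) simp
    then have "(\<lambda>\<zeta>. (D s \<zeta> - t s) + t s) \<in> O[at_infinity](\<lambda>\<zeta>. \<zeta> powi 0)"
      by (rule sum_in_bigo(1)) simp
    then show ?thesis by simp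
  qed
  \<comment> \<open>Replacing \<open>P s\<close> by its leading term and then \<open>D s\<close> by
    its limit costs only terms of order \<open>m - 1\<close>; what remains is a single
    power.\<close>
  have "(\<lambda>\<zeta>. (\<Sum>s\<in>S. P s \<zeta> * D s \<zeta>) - (\<Sum>s\<in>S. (P s \<zeta> - c s * \<zeta> powi m) * D s \<zeta>)
      - (\<Sum>s\<in>S. (c s * \<zeta> powi m) * (D s \<zeta> - t s))) \<in> O[at_infinity](\<lambda>\<zeta>. \<zeta> powi (m - 1))"
  proof (intro sum_in_bigo(2) PD big_sum_in_bigo)
    fix s assume "s \<in> S"
    show "(\<lambda>\<zeta>. (P s \<zeta> - c s * \<zeta> powi m) * D s \<zeta>) \<in> O[at_infinity](\<lambda>\<zeta>. \<zeta> powi (m - 1))"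
      using powi_bigo_mult[OF P[OF \<open>s \<in> S\<close>] D0[OF \<open>s \<in> S\<close>]] by simp
    have "(\<lambda>\<zeta>. c s * \<zeta> powi m) \<in> O[at_infinity](\<lambda>\<zeta>. \<zeta> powi m)"
      by (rule landau_o.big.cmult_in_iff'[THEN iffD2] | simp)+
    from powi_bigo_mult[OF this D[OF \<open>s \<in> S\<close>]]
    show "(\<lambda>\<zeta>. (c s * \<zeta> powi m) * (D s \<zeta> - t s)) \<in> O[at_infinity](\<lambda>\<zeta>. \<zeta> powi (m - 1))"
      by simp
  qed
  moreover have "(\<Sum>s\<in>S. P s \<zeta> * D s \<zeta>) - (\<Sum>s\<in>S. (P s \<zeta> - c s * \<zeta> powi m) * D s \<zeta>)
      - (\<Sum>s\<in>S. (c s * \<zeta> powi m) * (D s \<zeta> - t s)) = (\<Sum>s\<in>S. c s * t s) * \<zeta> powi m" for \<zeta>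
    by (simp add: algebra_simps sum.distrib sum_subtractf sum_distrib_left)
  ultimately show "(\<lambda>\<zeta>. (\<Sum>s\<in>S. c s * t s) * \<zeta> powi m) \<in> O[at_infinity](\<lambda>\<zeta>. \<zeta> powi (m - 1))"
    by (simp only:)
qed

section \<open>From matrices to their entries\<close>

lemma cscale_component: "(c *\<^sub>m A) $ i $ j = c * A $ i $ j"
  by (simp add: cscale_def map_matrix_def)

lemma bounded_linear_matrix_component: "bounded_linear (\<lambda>A :: 'n::finite cmat. A $ i $ j)"
  by (rule bounded_linear_compose[OF bounded_linear_vec_nth bounded_linear_vec_nth])

lemma matrix_expansion_component:
  assumes "matrix_expansion W m c F"
  shows "scalar_expansion W m (\<lambda>k x. c k x $ i $ j) (\<lambda>p. F p $ i $ j)"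
proof -
  have "(\<lambda>k. c k x $ i $ j * \<zeta> powi (m - int k)) sums F (x, \<zeta>) $ i $ j" if "(x, \<zeta>) \<in> W" for x \<zeta>
  proof -
    have "(\<lambda>k. \<zeta> powi (m - int k) *\<^sub>m c k x) sums F (x, \<zeta>)"
      using bspec[OF assms[unfolded matrix_expansion_def] that] by simp
    from bounded_linear.sums[OF bounded_linear_matrix_component this]
    show ?thesis by (simp add: cscale_component mult.commute)
  qed
  then show ?thesis by (auto simp: scalar_expansion_def)
qed

lemma matrix_expansion_sums:
  assumes "matrix_expansion (near_infinity \<Omega> r) m c F" "x \<in> \<Omega>" "norm \<zeta> > r x"
  shows "(\<lambda>k. c k x $ i $ j * \<zeta> powi (m - int k)) sums F (x, \<zeta>) $ i $ j"
  by (rule scalar_expansionD[OF matrix_expansion_component[OF assms(1)] assms(2,3)])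

lemma C1_on_bounded_linear_compose:
  assumes "C1_on F W" "bounded_linear l"
  shows "C1_on (\<lambda>p. l (F p)) W"
proof -
  obtain F' where F': "continuous_on W F'"
    "\<And>p. p \<in> W \<Longrightarrow> (F has_derivative blinfun_apply (F' p)) (at p)"
    using assms(1) by (auto simp: C1_on_def)
  show ?thesis
    unfolding C1_on_def
  proof (intro exI conjI ballI)
    show "continuous_on W (\<lambda>p. Blinfun l o\<^sub>L F' p)"
      by (intro continuous_intros F')
    have "blinfun_apply (Blinfun l o\<^sub>L F' p) = (\<lambda>v. l (F' p v))" for p
      by (auto simp: bounded_linear_Blinfun_apply[OF assms(2)])
    then show "((\<lambda>p. l (F p)) has_derivative blinfun_apply (Blinfun l o\<^sub>L F' p)) (at p)" if "p \<in> W" for p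
      using bounded_linear.has_derivative[OF assms(2) F'(2)[OF that]]
      by (simp only:)
  qed
qed

lemma total_deriv_bounded_linear:
  assumes "C1_on F W" "bounded_linear l" "p \<in> W"
  shows "total_deriv e \<Lambda> (\<lambda>p. l (F p)) p = l (total_deriv e \<Lambda> F p)"
proof -
  obtain F' where "(F has_derivative F') (at p)"
    using assms by (auto simp: C1_on_def)
  from total_deriv_eq[OF this] total_deriv_eq[OF bounded_linear.has_derivative[OF assms(2) this]]
  show ?thesis by simp
qed

lemma matrix_inv_left:
  fixes A :: "'a::semiring_1 ^ 'n ^ 'm"
  assumes "invertible A"
  shows "matrix_inv A ** A = mat 1"
  using someI_ex[OF assms[unfolded invertible_def]] by (simp add: matrix_inv_def)

lemma matrix_add_rdistrib:
  fixes A B :: "'a::semiring_1 ^ 'n ^ 'm"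
  shows "(A + B) ** C = A ** C + B ** C"
  by (simp add: matrix_matrix_mult_def vec_eq_iff distrib_right sum.distrib)

text \<open>Multiplying by \<open>D p\<close> on the right removes the inverse, so growth can be
  estimated without expanding \<open>matrix_inv (D p)\<close> at infinity.\<close>

lemma darboux_transform_mult:
  assumes "invertible (D p)"
  shows "darboux_transform e \<Lambda> D U p ** D p = total_deriv e \<Lambda> D p + D p ** U p"
  by (simp add: darboux_transform_def matrix_add_rdistrib matrix_inv_left[OF assms]
      flip: matrix_mul_assoc)

section \<open>Invariance of the constraints\<close>

theorem proposition8p1:
  fixes \<Omega> :: "plane set" and r :: "plane \<Rightarrow> real"
    and N M N' M' :: int and k :: nat
    and U V D :: "plane \<times> complex \<Rightarrow> complex ^ 'n::finite ^ 'n"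
    and u v u' v' T :: "nat \<Rightarrow> plane \<Rightarrow> complex ^ 'n ^ 'n"
    and \<Lambda>1 \<Lambda>2 :: "plane \<times> complex \<Rightarrow> complex"
    and a b h :: "nat \<Rightarrow> plane \<Rightarrow> complex"
  defines "W \<equiv> near_infinity \<Omega> r"
  assumes "open \<Omega>" and "continuous_on \<Omega> r" and "\<And>x. x \<in> \<Omega> \<Longrightarrow> r x \<ge> 0"
    and "N > 0" and "M > 0"
    and "matrix_expansion W N u U"
    and "matrix_expansion W M v V"
    and "scalar_expansion W N' a \<Lambda>1"
    and "scalar_expansion W M' b \<Lambda>2"
    and "matrix_expansion W 0 T D"
    and "C1_on D W"
    and "\<And>p. p \<in> W \<Longrightarrow> invertible (D p)"
    and "matrix_expansion W N u' (darboux_transform (1, 0) \<Lambda>1 D U)"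
    and "matrix_expansion W M v' (darboux_transform (0, 1) \<Lambda>2 D V)"
    and "\<And>x. x \<in> \<Omega> \<Longrightarrow> det (T 0 x) \<noteq> 0"
    and "int k \<le> k_max1 N M N' M'"
    and "linear_constraints \<Omega> k h u v"
  shows "linear_constraints \<Omega> k h u' v'"
proof -
  have W: "(x, \<zeta>) \<in> W" if "x \<in> \<Omega>" "norm \<zeta> > r x" for x \<zeta>
    using that by (simp add: W_def near_infinity_def)
  note entry_sums = matrix_expansion_sums[where \<Omega> = \<Omega> and r = r, folded W_def]
  note constraints = \<open>linear_constraints \<Omega> k h u v\<close>[unfolded linear_constraints_def, rule_format]
  \<comment> \<open>For \<open>j \<le> k\<close>, the first and third bounds give
    \<open>max 0 (N' - 2) \<le> N - j - 1\<close>, which controls \<open>D,1\<close>; the second and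
    fourth give \<open>N - M + max 0 (M' - 2) \<le> N - j - 1\<close>, which controls
    \<open>H D,2\<close>.\<close>
  have k: "int k \<le> N - 1" "int k \<le> M - 1" "int k \<le> N + 1 - N'" "int k \<le> M + 1 - M'"
    using \<open>int k \<le> k_max1 N M N' M'\<close> by (auto simp: k_max1_def)
  \<comment> \<open>The remainders of the series of \<open>D\<close> after no term and after one
    term.\<close>
  have D_bigo: "(\<lambda>\<zeta>. D (x, \<zeta>) $ p $ q) \<in> O[at_infinity](\<lambda>\<zeta>. \<zeta> powi 0)"
    and D_lim: "(\<lambda>\<zeta>. D (x, \<zeta>) $ p $ q - T 0 x $ p $ q) \<in> O[at_infinity](\<lambda>\<zeta>. \<zeta> powi - 1)"
    if "x \<in> \<Omega>" for x p q
    using laurent_remainder_bigo[of "r x", OF entry_sums[OF \<open>matrix_expansion W 0 T D\<close> that, where i = p and j = q], of 0]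
      laurent_remainder_bigo[of "r x", OF entry_sums[OF \<open>matrix_expansion W 0 T D\<close> that, where i = p and j = q], of 1]
    by simp_all
  have D1: "(\<lambda>\<zeta>. total_deriv (1, 0) \<Lambda>1 D (x, \<zeta>) $ p $ q) \<in> O[at_infinity](\<lambda>\<zeta>. \<zeta> powi max 0 (N' - 2))"
    and D2: "(\<lambda>\<zeta>. total_deriv (0, 1) \<Lambda>2 D (x, \<zeta>) $ p $ q) \<in> O[at_infinity](\<lambda>\<zeta>. \<zeta> powi max 0 (M' - 2))"
    if "x \<in> \<Omega>" for x p q
  proof -
    have *: "(\<lambda>\<zeta>. total_deriv e \<Lambda> D (x, \<zeta>) $ p $ q) \<in> O[at_infinity](\<lambda>\<zeta>. \<zeta> powi max 0 (m - 2))"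
      if "scalar_expansion W m a \<Lambda>" for e m a \<Lambda>
    proof -
      have "(\<lambda>\<zeta>. total_deriv e \<Lambda> (\<lambda>y. D y $ p $ q) (x, \<zeta>)) \<in> O[at_infinity](\<lambda>\<zeta>. \<zeta> powi max 0 (m - 2))"
        using assms(2,3) \<open>x \<in> \<Omega>\<close> matrix_expansion_component[OF \<open>matrix_expansion W 0 T D\<close>, of p q]
          C1_on_bounded_linear_compose[OF \<open>C1_on D W\<close> bounded_linear_matrix_component, of p q] that
        unfolding W_def by (rule total_deriv_bigo)
      also have "?this \<longleftrightarrow> ?thesis"
      proof (rule landau_o.big.in_cong)
        show "eventually (\<lambda>\<zeta>. total_deriv e \<Lambda> (\<lambda>y. D y $ p $ q) (x, \<zeta>) = total_deriv e \<Lambda> D (x, \<zeta>) $ p $ q) at_infinity"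
          unfolding eventually_at_infinity
          by (rule exI[of _ "r x + 1"])
            (auto intro!: total_deriv_bounded_linear[OF \<open>C1_on D W\<close> bounded_linear_matrix_component] W \<open>x \<in> \<Omega>\<close>)
      qed
      finally show ?thesis .
    qed
    show "(\<lambda>\<zeta>. total_deriv (1, 0) \<Lambda>1 D (x, \<zeta>) $ p $ q) \<in> O[at_infinity](\<lambda>\<zeta>. \<zeta> powi max 0 (N' - 2))"
      "(\<lambda>\<zeta>. total_deriv (0, 1) \<Lambda>2 D (x, \<zeta>) $ p $ q) \<in> O[at_infinity](\<lambda>\<zeta>. \<zeta> powi max 0 (M' - 2))"
      using * assms(9,10) by blast+
  qed
  define E where "E = (\<lambda>j x. u' j x + (\<Sum>i=0..j. h i x *\<^sub>m v' (j - i) x))"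
  have E_component: "E l x $ p $ q = u' l x $ p $ q + (\<Sum>i\<le>l. h i x * v' (l - i) x $ p $ q)" for l x p q
    by (simp add: E_def cscale_component atLeast0AtMost)
  text \<open>Once \<open>E l x = 0\<close> for \<open>l < j\<close>, the product of \<open>U' + H V'\<close> and \<open>D\<close> has leading term
    \<open>E j x T\<^sub>0 \<zeta>\<^bsup>N - j\<^esup>\<close>.\<close>
  have "E j x = 0" if "j \<le> k" "x \<in> \<Omega>" for j x
    using that(1)
  proof (induction j rule: less_induct)
    case (less j)
    \<comment> \<open>\<open>H\<close> is cut at the current index \<open>j\<close>: any later term
      would affect only the order \<open>N - j - 1\<close> and below.\<close>
    define H where "H = (\<lambda>\<zeta>. \<Sum>i\<le>j. h i x * \<zeta> powi (N - M - int i))"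
    define U' where "U' = darboux_transform (1, 0) \<Lambda>1 D U"
    define V' where "V' = darboux_transform (0, 1) \<Lambda>2 D V"
    have H: "H \<in> O[at_infinity](\<lambda>\<zeta>. \<zeta> powi (N - M))"
      unfolding H_def
    proof (rule big_sum_in_bigo)
      fix i
      have "(\<lambda>\<zeta>. \<zeta> powi (N - M - int i)) \<in> O[at_infinity](\<lambda>\<zeta>::complex. \<zeta> powi (N - M))"
        by (rule powi_bigo_mono) simp
      then show "(\<lambda>\<zeta>. h i x * \<zeta> powi (N - M - int i)) \<in> O[at_infinity](\<lambda>\<zeta>. \<zeta> powi (N - M))"
        by simp
    qed
    have old: "(\<lambda>\<zeta>. U (x, \<zeta>) $ p $ q + H \<zeta> * V (x, \<zeta>) $ p $ q) \<in> O[at_infinity](\<lambda>\<zeta>. \<zeta> powi (N - int j - 1))"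
      for p q
    proof -
      have "u l x $ p $ q + (\<Sum>i\<le>l. h i x * v (l - i) x $ p $ q) = 0" if "l \<le> j" for l
        using arg_cong[where f = "\<lambda>A. A $ p $ q", OF constraints[of l x]] that less.prems \<open>x \<in> \<Omega>\<close>
        by (simp add: cscale_component atLeast0AtMost)
      then show ?thesis
        using laurent_constraint_bigo[of "r x", OF entry_sums[OF assms(7) \<open>x \<in> \<Omega>\<close>, where i = p and j = q]
            entry_sums[OF assms(8) \<open>x \<in> \<Omega>\<close>, where i = p and j = q], where h = "\<lambda>i. h i x" and j = j]
        by (simp add: H_def)
    qed
    have new: "(\<lambda>\<zeta>. (U' (x, \<zeta>) $ p $ q + H \<zeta> * V' (x, \<zeta>) $ p $ q) - E j x $ p $ q * \<zeta> powi (N - int j))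
        \<in> O[at_infinity](\<lambda>\<zeta>. \<zeta> powi (N - int j - 1))" for p q
    proof -
      \<comment> \<open>The induction hypothesis removes all terms with
        \<open>l < j\<close>.\<close>
      have "(\<Sum>l\<le>j. E l x $ p $ q * \<zeta> powi (N - int l)) = E j x $ p $ q * \<zeta> powi (N - int j)" for \<zeta>
        using less by (intro sum.mono_neutral_cong_right[where S = "{j}", simplified]) auto
      then show ?thesis
        using laurent_constraint_bigo[of "r x", OF entry_sums[OF assms(14) \<open>x \<in> \<Omega>\<close>, where i = p and j = q]
            entry_sums[OF assms(15) \<open>x \<in> \<Omega>\<close>, where i = p and j = q], where h = "\<lambda>i. h i x" and j = j]
        by (simp add: H_def U'_def V'_def flip: E_component)
    qed
    \<comment> \<open>Row \<open>p\<close> of \<open>E j x\<close> is paired with column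
      \<open>q\<close> of \<open>T 0 x\<close>, taking \<open>m = N - int j\<close> in the
      comparison of leading coefficients.\<close>
    have "E j x ** T 0 x = 0"
    proof (simp add: vec_eq_iff matrix_matrix_mult_def, intro allI, rule leading_coefficients_orthogonal)
      fix p q s
      show "(\<lambda>\<zeta>. (U' (x, \<zeta>) $ p $ s + H \<zeta> * V' (x, \<zeta>) $ p $ s) - E j x $ p $ s * \<zeta> powi (N - int j))
        \<in> O[at_infinity](\<lambda>\<zeta>. \<zeta> powi (N - int j - 1))"
        by (rule new)
      show "(\<lambda>\<zeta>. D (x, \<zeta>) $ s $ q - T 0 x $ s $ q) \<in> O[at_infinity](\<lambda>\<zeta>. \<zeta> powi - 1)"
        by (rule D_lim[OF \<open>x \<in> \<Omega>\<close>])
    next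
      fix p q
      have "(\<lambda>\<zeta>. total_deriv (1, 0) \<Lambda>1 D (x, \<zeta>) $ p $ q + H \<zeta> * total_deriv (0, 1) \<Lambda>2 D (x, \<zeta>) $ p $ q
          + (\<Sum>s\<in>UNIV. D (x, \<zeta>) $ p $ s * (U (x, \<zeta>) $ s $ q + H \<zeta> * V (x, \<zeta>) $ s $ q)))
        \<in> O[at_infinity](\<lambda>\<zeta>. \<zeta> powi (N - int j - 1))"
      proof (intro sum_in_bigo(1) big_sum_in_bigo)
        show "(\<lambda>\<zeta>. total_deriv (1, 0) \<Lambda>1 D (x, \<zeta>) $ p $ q) \<in> O[at_infinity](\<lambda>\<zeta>. \<zeta> powi (N - int j - 1))"
          by (rule landau_o.big_trans[OF D1[OF \<open>x \<in> \<Omega>\<close>] powi_bigo_mono]) (use k less.prems in auto)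
        show "(\<lambda>\<zeta>. H \<zeta> * total_deriv (0, 1) \<Lambda>2 D (x, \<zeta>) $ p $ q) \<in> O[at_infinity](\<lambda>\<zeta>. \<zeta> powi (N - int j - 1))"
          by (rule landau_o.big_trans[OF powi_bigo_mult[OF H D2[OF \<open>x \<in> \<Omega>\<close>]] powi_bigo_mono])
            (use k less.prems in auto)
        show "(\<lambda>\<zeta>. D (x, \<zeta>) $ p $ s * (U (x, \<zeta>) $ s $ q + H \<zeta> * V (x, \<zeta>) $ s $ q))
          \<in> O[at_infinity](\<lambda>\<zeta>. \<zeta> powi (N - int j - 1))" for s
          using powi_bigo_mult[OF D_bigo[OF \<open>x \<in> \<Omega>\<close>] old] by simp
      qed
      \<comment> \<open>\<open>H\<close> is scalar and commutes with matrices, so combining the two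
        transformation formulas, each multiplied by \<open>D\<close>, gives this identity wherever
        \<open>norm \<zeta> > r x\<close>.\<close>
      also have "?this \<longleftrightarrow> (\<lambda>\<zeta>. \<Sum>s\<in>UNIV. (U' (x, \<zeta>) $ p $ s + H \<zeta> * V' (x, \<zeta>) $ p $ s) * D (x, \<zeta>) $ s $ q)
        \<in> O[at_infinity](\<lambda>\<zeta>. \<zeta> powi (N - int j - 1))"
      proof (rule landau_o.big.in_cong)
        have "total_deriv (1, 0) \<Lambda>1 D (x, \<zeta>) $ p $ q + H \<zeta> * total_deriv (0, 1) \<Lambda>2 D (x, \<zeta>) $ p $ q
            + (\<Sum>s\<in>UNIV. D (x, \<zeta>) $ p $ s * (U (x, \<zeta>) $ s $ q + H \<zeta> * V (x, \<zeta>) $ s $ q))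
          = (\<Sum>s\<in>UNIV. (U' (x, \<zeta>) $ p $ s + H \<zeta> * V' (x, \<zeta>) $ p $ s) * D (x, \<zeta>) $ s $ q)"
          if "norm \<zeta> > r x" for \<zeta>
        proof -
          have inv: "invertible (D (x, \<zeta>))" using assms(13) W[OF \<open>x \<in> \<Omega>\<close> that] by blast
          have "(U' (x, \<zeta>) ** D (x, \<zeta>)) $ p $ q + H \<zeta> * (V' (x, \<zeta>) ** D (x, \<zeta>)) $ p $ q
            = (total_deriv (1, 0) \<Lambda>1 D (x, \<zeta>) + D (x, \<zeta>) ** U (x, \<zeta>)) $ p $ q
              + H \<zeta> * (total_deriv (0, 1) \<Lambda>2 D (x, \<zeta>) + D (x, \<zeta>) ** V (x, \<zeta>)) $ p $ q"
            by (simp only: U'_def V'_def darboux_transform_mult[of D, OF inv])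
          then show ?thesis
            by (simp add: matrix_matrix_mult_def sum_distrib_left sum.distrib algebra_simps)
        qed
        then show "eventually (\<lambda>\<zeta>. total_deriv (1, 0) \<Lambda>1 D (x, \<zeta>) $ p $ q + H \<zeta> * total_deriv (0, 1) \<Lambda>2 D (x, \<zeta>) $ p $ q
            + (\<Sum>s\<in>UNIV. D (x, \<zeta>) $ p $ s * (U (x, \<zeta>) $ s $ q + H \<zeta> * V (x, \<zeta>) $ s $ q))
          = (\<Sum>s\<in>UNIV. (U' (x, \<zeta>) $ p $ s + H \<zeta> * V' (x, \<zeta>) $ p $ s) * D (x, \<zeta>) $ s $ q)) at_infinity"
          unfolding eventually_at_infinity by (intro exI[of _ "r x + 1"]) simp
      qed
      finally show "(\<lambda>\<zeta>. \<Sum>s\<in>UNIV. (U' (x, \<zeta>) $ p $ s + H \<zeta> * V' (x, \<zeta>) $ p $ s) * D (x, \<zeta>) $ s $ q)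
        \<in> O[at_infinity](\<lambda>\<zeta>. \<zeta> powi (N - int j - 1))" .
    qed
    \<comment> \<open>The determinant condition enters here: a right inverse of \<open>T 0 x\<close>
      cancels it from \<open>E j x ** T 0 x = 0\<close>.\<close>
    moreover obtain S where "T 0 x ** S = mat 1"
      using assms(16)[OF \<open>x \<in> \<Omega>\<close>] by (auto simp: invertible_def simp flip: invertible_det_nz)
    ultimately have "E j x = 0 ** S"
      by (metis matrix_mul_assoc matrix_mul_rid)
    then show "E j x = 0"
      by (simp add: matrix_matrix_mult_def vec_eq_iff)
  qed
  then show ?thesis
    by (simp add: linear_constraints_def E_def)
qed

end
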